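(* Let $G=(V,E)$ be a weakly connected directed acyclic graph with fixed delays $m_{i,j}$, and let $(\mathcal{N}^e,\mathcal{N}^m)$ be an identification pattern in which all the sources are excited, all the sinks are measured, and every other node is excited or measured. Then $G$ is identifiable in the class $\mathcal{F}_{Z,NL}$ with the identification pattern $(\mathcal{N}^e,\mathcal{N}^m)$ if and only if it is identifiable in the class $\mathcal{F}_{Z,NL}$ with the identification pattern $(\mathcal{N}^e,V)$.
   Context: Graph. $G=(V,E)$ is a weakly connected directed acyclic graph (DAG), $V=\{1,\dots,n\}$, $E\subseteq V\times V$. An element $(i,j)\in E$ denotes an edge from $j$ to $i$; $\mathcal{N}_i=\{j:(i,j)\in E\}$ is the set of in-neighbors of $i$. A source is a node with no in-neighbors; a sink is a node with no out-neighbors. Identification pattern. A pair $(\mathcal{N}^e,\mathcal{N}^m)$ with $\mathcal{N}^e\subseteq V$ (excited nodes) and $\mathcal{N}^m\subseteq V$ (measured nodes). Model. Each edge $(i,j)\in E$ carries a fixed known finite delay $m_{i,j}\in\{1,2,\dots\}$ and a function $f_{i,j}:\mathbb{R}\to\mathbb{R}$. The node outputs satisfy, at each time $k$, $$y_i^k=\sum_{j\in\mathcal{N}_i} f_{i,j}\big(y_j^{k-m_{i,j}}\big)+u_i^{k-1},\qquad i\in V,$$ where superscripts denote time instants, $u_i$ is an arbitrary real excitation signal if $i\in\mathcal{N}^e$, and $u_i\equiv 0$ if $i\notin\mathcal{N}^e$. The functions $F_i$. Since $G$ is acyclic, unrolling the model gives $y_i^k=u_i^{k-1}+F_i$, where $F_i$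 is a function of finitely many delayed values $u_j^{k-s}$ of the excitation signals of excited nodes $j$ having a path to $i$. Explicitly, $F_i=\sum_{j\in\mathcal{N}_i} f_{i,j}\big(u_j^{k-m_{i,j}-1}+F_j^{(m_{i,j})}\big)$, where $F_j^{(s)}$ is $F_j$ with all its inputs delayed by $s$, and $u_j=0$ for non-excited $j$. The set of measured functions is $F(\mathcal{N}^m)=\{F_i: i\in\mathcal{N}^m\}$. For another family $\{\tilde f\}=\{\tilde f_{i,j}\}$ on the same graph with the same delays and pattern, $\tilde F_i$ denotes the corresponding functions; $F(\mathcal{N}^m)=\tilde F(\mathcal{N}^m)$ means $F_i=\tilde F_i$ as functions (for all real values of the inputs) for each $i\in\mathcal{N}^m$. Class $\mathcal{F}_{Z,NL}$. The set of $f:\mathbb{R}\to\mathbb{R}$ such that: (1) $f$ is real analytic on $\mathbb{R}$; (2) $f(0)=0$; (3) the Taylor series $f(x)=\sum_{n\ge1}a_nx^n$ at $0$ has some $a_n\ne0$ with $n>1$; (4) the range of $f$ is $\mathbb{R}$. Identifiability. $G$ is identifiable in $\mathcal{F}_{Z,NL}$ with $(\mathcal{N}^e,\mathcal{N}^m)$ if, for all families $\{f_{i,j}\}_{(i,j)\in E}$ and $\{\tilde f_{i,j}\}_{(i,j)\in E}$ of functions in $\mathcal{F}_{Z,NL}$, $F(\mathcal{N}^m)=\tilde F(\mathcal{N}^m)$ implies $f_{i,j}=\tilde f_{i,j}$ for all $(i,j)\in E$. *)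

theory Defs
  imports "HOL-Analysis.Analysis"
begin

section \<open>Directed acyclic graphs\<close>

text \<open>A pair \<open>(i, j) \<in> E\<close> is an edge from \<open>j\<close> to \<open>i\<close>.\<close>

definition in_nbrs :: "(nat \<times> nat) set \<Rightarrow> nat \<Rightarrow> nat set" where
  "in_nbrs E i = {j. (i, j) \<in> E}"

definition out_nbrs :: "(nat \<times> nat) set \<Rightarrow> nat \<Rightarrow> nat set" where
  "out_nbrs E j = {i. (i, j) \<in> E}"

definition sources :: "nat set \<Rightarrow> (nat \<times> nat) set \<Rightarrow> nat set" where
  "sources V E = {i \<in> V. in_nbrs E i = {}}"

definition sinks :: "nat set \<Rightarrow> (nat \<times> nat) set \<Rightarrow> nat set" where
  "sinks V E = {i \<in> V. out_nbrs E i = {}}"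

definition weakly_connected :: "nat set \<Rightarrow> (nat \<times> nat) set \<Rightarrow> bool" where
  "weakly_connected V E \<longleftrightarrow> V \<noteq> {} \<and> (\<forall>i\<in>V. \<forall>j\<in>V. (i, j) \<in> (E \<union> E\<inverse>)\<^sup>*)"

definition weakly_connected_dag :: "nat set \<Rightarrow> (nat \<times> nat) set \<Rightarrow> bool" where
  "weakly_connected_dag V E \<longleftrightarrow> E \<subseteq> V \<times> V \<and> acyclic E \<and> weakly_connected V E"


section \<open>The network model and the functions \<open>F\<^sub>i\<close>\<close>

text \<open>
  An argument \<open>w :: nat \<Rightarrow> nat \<Rightarrow> real\<close> of \<open>F\<^sub>i\<close> lists delayed excitation values:
  \<open>w j s\<close> stands for \<open>u\<^sub>j\<close> at time \<open>k - s\<close>, where \<open>k\<close> is the current time.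
  Only finitely many of these values, all belonging to excited nodes, enter \<open>F\<^sub>i\<close>.
\<close>

definition delay :: "nat \<Rightarrow> (nat \<Rightarrow> nat \<Rightarrow> real) \<Rightarrow> nat \<Rightarrow> nat \<Rightarrow> real" where
  "delay s w = (\<lambda>j r. w j (r + s))"

text \<open>
  The recursion runs along in-edges, which is well-founded when the graph is finite and
  acyclic; the resulting equation is \<open>node_fun_eq\<close> below.
\<close>

definition node_fun ::
  "(nat \<times> nat) set \<Rightarrow> (nat \<Rightarrow> nat \<Rightarrow> nat) \<Rightarrow> nat set \<Rightarrow> (nat \<Rightarrow> nat \<Rightarrow> real \<Rightarrow> real)
    \<Rightarrow> nat \<Rightarrow> (nat \<Rightarrow> nat \<Rightarrow> real) \<Rightarrow> real" where
  "node_fun E m Ne f = wfrec (E\<inverse>) (\<lambda>F i w.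
     \<Sum>j\<in>in_nbrs E i.
       f i j ((if j \<in> Ne then w j (m i j + 1) else 0) + F j (delay (m i j) w)))"

lemma node_fun_eq:
  assumes "finite E" and "acyclic E"
  shows "node_fun E m Ne f i w =
    (\<Sum>j\<in>in_nbrs E i.
       f i j ((if j \<in> Ne then w j (m i j + 1) else 0) + node_fun E m Ne f j (delay (m i j) w)))"
proof -
  have "wf (E\<inverse>)"
    using assms by (rule finite_acyclic_wf_converse)
  then show ?thesis
    unfolding node_fun_def
    by (subst wfrec) (auto simp: in_nbrs_def cut_def intro!: sum.cong)
qed

text \<open>
  The link with the dynamics: in every trajectory of the model, the output of node \<open>i\<close>
  is its own excitation plus \<open>F\<^sub>i\<close> evaluated at the past excitations.
\<close>

definition trajectory ::
  "nat set \<Rightarrow> (nat \<times> nat) set \<Rightarrow> (nat \<Rightarrow> nat \<Rightarrow> nat) \<Rightarrow> nat set \<Rightarrow> (nat \<Rightarrow> nat \<Rightarrow> real \<Rightarrow> real)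
    \<Rightarrow> (nat \<Rightarrow> int \<Rightarrow> real) \<Rightarrow> (nat \<Rightarrow> int \<Rightarrow> real) \<Rightarrow> bool" where
  "trajectory V E m Ne f u y \<longleftrightarrow>
     (\<forall>i\<in>V - Ne. \<forall>k. u i k = 0) \<and>
     (\<forall>i\<in>V. \<forall>k. y i k = (\<Sum>j\<in>in_nbrs E i. f i j (y j (k - int (m i j)))) + u i (k - 1))"

lemma trajectory_node_fun:
  assumes "finite E" and "acyclic E" and "E \<subseteq> V \<times> V"
    and traj: "trajectory V E m Ne f u y" and "i \<in> V"
  shows "y i k = u i (k - 1) + node_fun E m Ne f i (\<lambda>j s. u j (k - int s))"
  using \<open>i \<in> V\<close>
proof (induction i arbitrary: k rule: wf_induct_rule[OF finite_acyclic_wf_converse[OF assms(1,2)]])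
  case (1 i)
  have "f i j (y j (k - int (m i j))) =
      f i j ((if j \<in> Ne then u j (k - int (m i j + 1)) else 0) +
        node_fun E m Ne f j (delay (m i j) (\<lambda>j s. u j (k - int s))))"
    if "j \<in> in_nbrs E i" for j
  proof -
    have E: "(j, i) \<in> E\<inverse>" and "j \<in> V"
      using that assms(3) by (auto simp: in_nbrs_def)
    then have "j \<notin> Ne \<Longrightarrow> u j t = 0" for t
      using traj by (auto simp: trajectory_def)
    then show ?thesis
      using 1(1)[OF E \<open>j \<in> V\<close>, of "k - int (m i j)"] by (simp add: delay_def algebra_simps)
  qed
  moreover have "y i k = (\<Sum>j\<in>in_nbrs E i. f i j (y j (k - int (m i j)))) + u i (k - 1)"
    using traj 1(2) by (auto simp: trajectory_def)
  ultimately show ?case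
    by (subst node_fun_eq[OF assms(1,2)]) simp
qed


section \<open>The function class and identifiability\<close>

definition real_analytic :: "(real \<Rightarrow> real) \<Rightarrow> bool" where
  "real_analytic f \<longleftrightarrow> (\<forall>x. \<exists>A. (\<lambda>h. f (x + h)) has_fps_expansion A)"

definition F_ZNL :: "(real \<Rightarrow> real) set" where
  "F_ZNL = {f. real_analytic f \<and> f 0 = 0 \<and>
     (\<exists>A. f has_fps_expansion A \<and> (\<exists>n>1. fps_nth A n \<noteq> 0)) \<and>
     range f = UNIV}"

definition identifiable ::
  "(real \<Rightarrow> real) set \<Rightarrow> (nat \<times> nat) set \<Rightarrow> (nat \<Rightarrow> nat \<Rightarrow> nat) \<Rightarrow> nat set \<Rightarrow> nat set \<Rightarrow> bool" where
  "identifiable C E m Ne Nm \<longleftrightarrow>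
     (\<forall>f g. (\<forall>(i, j)\<in>E. f i j \<in> C) \<longrightarrow> (\<forall>(i, j)\<in>E. g i j \<in> C) \<longrightarrow>
        (\<forall>i\<in>Nm. node_fun E m Ne f i = node_fun E m Ne g i) \<longrightarrow>
        (\<forall>(i, j)\<in>E. f i j = g i j))"

end

theory Submission
  imports Defs
begin

text \<open>
  An unmeasured node \<open>j\<close> is excited and not a sink. Let \<open>i\<close> be a topologically first
  out-neighbour of \<open>j\<close>. The edge from \<open>j\<close> is then the only path from \<open>j\<close> to \<open>i\<close>, so with all
  inputs other than \<open>u\<^sub>j = x\<close> held fixed, \<open>F\<^sub>i\<close> has the form \<open>f\<^sub>i\<^sub>j (x + F\<^sub>j) + R\<close> with \<open>F\<^sub>j\<close> and
  \<open>R\<close> independent of \<open>x\<close>. If \<open>F\<^sub>i\<close> is the same for both families, zero inputs give the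
  equality of the two edge functions, and then shifting the argument by
  \<open>d = F\<^sub>j - F\<^sub>j'\<close>, the difference of the two node functions at \<open>j\<close>, changes \<open>f\<^sub>i\<^sub>j\<close> by a
  constant. Scaling the inputs makes \<open>d\<close> run through an interval at \<open>0\<close>
  unless \<open>F\<^sub>j = F\<^sub>j'\<close>, and a differentiable function with this property for an interval of shifts is
  affine, which nonlinearity excludes. Hence, going backwards from the sinks, the measured functions
  determine all node functions.
\<close>

section \<open>Power series expansions, and shifts that change a function by a constant\<close>

lemma has_fps_expansion_zero_nth:
  fixes A :: "real fps"
  assumes "f has_fps_expansion A" and "\<forall>\<^sub>F x in nhds 0. f x = 0"
  shows "fps_nth A k = 0"
  using assms
proof (induction k arbitrary: f A)
  case 0
  then have "f 0 = 0" "eval_fps A 0 = f 0"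
    by (auto simp: has_fps_expansion_def dest: eventually_nhds_x_imp_x)
  then show ?case
    by (simp add: eval_fps_at_0)
next
  case (Suc k)
  \<comment> \<open>Being zero near 0 passes to the derivative, whose expansion carries coefficient
    \<open>Suc k\<close> of \<open>A\<close> down to index \<open>k\<close>.\<close>
  have "\<forall>\<^sub>F x in nhds 0. deriv f x = 0"
    using iffD2[OF eventually_eventually Suc.prems(2)]
  proof eventually_elim
    case (elim x)
    then have "deriv f x = deriv (\<lambda>_. 0) x"
      by (intro deriv_cong_ev refl)
    then show ?case
      by simp
  qed
  then have "fps_nth (fps_deriv A) k = 0"
    using Suc.IH has_fps_expansion_deriv Suc.prems(1) by blast
  then show ?case
    by simp
qed

lemma real_analytic_imp_differentiable:
  assumes "real_analytic f"
  shows "\<exists>D. (f has_field_derivative D) (at x)"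
proof -
  obtain A where A: "(\<lambda>h. f (x + h)) has_fps_expansion A"
    using assms by (auto simp: real_analytic_def)
  then have rad: "fps_conv_radius A > 0" and ev: "\<forall>\<^sub>F h in nhds 0. eval_fps A h = f (x + h)"
    by (auto simp: has_fps_expansion_def)
  have "(eval_fps A has_field_derivative eval_fps (fps_deriv A) 0) (at 0)"
    using rad by (intro has_field_derivative_eval_fps) (simp add: zero_ereal_def)
  then have "((\<lambda>h. f (x + h)) has_field_derivative eval_fps (fps_deriv A) 0) (at 0)"
    by (subst (asm) DERIV_cong_ev[OF refl ev refl])
  then show ?thesis
    using DERIV_shift[of f _ 0 x] by (auto simp: add.commute)
qed

text \<open>Subtracting \<open>c * x\<close> alters no coefficient of order above 1, so a nonzero
  one would survive in an expansion of the zero function.\<close>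

lemma F_ZNL_not_linear:
  assumes "f \<in> F_ZNL"
  shows "f \<noteq> (\<lambda>x. c * x)"
proof
  assume lin: "f = (\<lambda>x. c * x)"
  obtain A k where A: "f has_fps_expansion A" and k: "k > 1" "fps_nth A k \<noteq> 0"
    using assms by (auto simp: F_ZNL_def)
  have "(\<lambda>x. f x - c * x) has_fps_expansion A - fps_const c * fps_X"
    by (intro has_fps_expansion_diff A has_fps_expansion_cmult_left has_fps_expansion_fps_X)
  then have "fps_nth (A - fps_const c * fps_X) k = 0"
    by (rule has_fps_expansion_zero_nth) (simp add: lin)
  moreover have "fps_nth (A - fps_const c * fps_X) k = fps_nth A k"
    using k(1) by (simp only: fps_sub_nth fps_mult_left_const_nth fps_X_nth) simp
  ultimately show False
    using k(2) by argo
qed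

lemma additive_from_interval:
  fixes f :: "real \<Rightarrow> real"
  assumes "d \<noteq> 0" and add: "\<And>e x. e \<in> closed_segment 0 d \<Longrightarrow> f (x + e) = f x + f e"
    and "f 0 = 0"
  shows "f (x + y) = f x + f y"
proof -
  have multiple: "f (x + real k * e) = f x + real k * f e" if "e \<in> closed_segment 0 d" for k e x
  proof (induction k)
    case (Suc k)
    have "f (x + real (Suc k) * e) = f ((x + real k * e) + e)"
      by (simp add: algebra_simps)
    also have "\<dots> = f x + real (Suc k) * f e"
      unfolding add[OF that] Suc.IH by (simp add: algebra_simps)
    finally show ?case .
  qed simp
  have same_sign: "f (x + y) = f x + f y" if "y / d \<ge> 0" for x y
  proof -
    define q where "q = y / d"
    have "q \<ge> 0" "y = q * d"
      using that \<open>d \<noteq> 0\<close> by (simp_all add: q_def)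
    \<comment> \<open>For large \<open>k\<close>, \<open>y / k\<close> lies in the segment; adding
      it \<open>k\<close> times, from \<open>x\<close> and from 0, gives the two values to
      compare.\<close>
    obtain k where k: "q < real k"
      using reals_Archimedean2 by blast
    have "real k > 0"
      using \<open>q \<ge> 0\<close> k by linarith
    then have "0 \<le> q / real k" "q / real k \<le> 1"
      using \<open>q \<ge> 0\<close> k by simp_all
    moreover have "y / real k = (1 - q / real k) *\<^sub>R 0 + (q / real k) *\<^sub>R d"
      by (simp add: \<open>y = q * d\<close>)
    ultimately have "y / real k \<in> closed_segment 0 d"
      unfolding in_segment by blast
    note multiple[OF this, of _ k]
    from this[of x] this[of 0] show ?thesis
      using \<open>real k > 0\<close> \<open>f 0 = 0\<close> by simp
  qed
  show ?thesis
  proof (cases "y / d \<ge> 0")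
    case False
    then have "- y / d \<ge> 0"
      by simp
    then have "f (z - y) = f z + f (- y)" for z
      using same_sign[of "- y" z] by simp
    \<comment> \<open>These two instances give \<open>f x = f (x + y) + f (- y)\<close> and
      \<open>0 = f y + f (- y)\<close>.\<close>
    from this[of "x + y"] this[of y] show ?thesis
      using \<open>f 0 = 0\<close> by simp
  qed (rule same_sign)
qed

text \<open>Putting \<open>x = 0\<close> shows that the constant is \<open>f e\<close>, so
  \<open>f\<close> is additive. Additivity carries the derivative at 0 to every point, which makes
  \<open>f\<close> linear.\<close>

lemma F_ZNL_shift_constant_interval:
  assumes f: "f \<in> F_ZNL"
    and shift: "\<And>e. e \<in> closed_segment 0 d \<Longrightarrow> \<exists>c. \<forall>x. f (x + e) = f x + c"
  shows "d = 0"
proof (rule ccontr)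
  assume "d \<noteq> 0"
  have f0: "f 0 = 0" and an: "real_analytic f"
    using f by (auto simp: F_ZNL_def)
  have "f (x + e) = f x + f e" if "e \<in> closed_segment 0 d" for e x
    using shift[OF that] f0 by (metis add_0)
  then have add: "f (x + y) = f x + f y" for x y
    using additive_from_interval[where f = f and d = d] \<open>d \<noteq> 0\<close> f0 by blast
  obtain D where D: "(f has_field_derivative D) (at 0)"
    using real_analytic_imp_differentiable[OF an] by blast
  have "((\<lambda>y. f y - D * y) has_field_derivative 0) (at x)" for x
  proof -
    have "((\<lambda>h. f (h + x)) has_field_derivative D) (at 0)"
      unfolding add by (rule derivative_eq_intros D refl)+ simp
    then have "(f has_field_derivative D) (at x)"
      using DERIV_shift[of f D 0 x] by simp
    then show ?thesis
      by (auto intro!: derivative_eq_intros)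
  qed
  then have "f x - D * x = f 0 - D * 0" for x
    by (intro DERIV_isconst_all) blast
  then have "f x = D * x" for x
    by (simp add: f0)
  then show False
    by (rule notE[OF F_ZNL_not_linear[OF f] ext])
qed

section \<open>Dependence of the node functions on their inputs\<close>

lemma node_fun_cong:
  assumes "finite E" and "acyclic E"
    and "\<And>l s. (i, l) \<in> E\<^sup>+ \<Longrightarrow> v l s = w l s"
  shows "node_fun E m Ne f i v = node_fun E m Ne f i w"
  using assms(3)
proof (induction i arbitrary: v w rule: wf_induct_rule[OF finite_acyclic_wf_converse[OF assms(1,2)]])
  case (1 i)
  have "v j (m i j + 1) = w j (m i j + 1)"
    and "node_fun E m Ne f j (delay (m i j) v) = node_fun E m Ne f j (delay (m i j) w)"
    if "j \<in> in_nbrs E i" for j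
  proof -
    have e: "(i, j) \<in> E"
      using that by (simp add: in_nbrs_def)
    show "v j (m i j + 1) = w j (m i j + 1)"
      using e by (intro 1(2)) auto
    show "node_fun E m Ne f j (delay (m i j) v) = node_fun E m Ne f j (delay (m i j) w)"
      using e by (intro 1(1)) (auto simp: delay_def intro: 1(2) trancl_into_trancl2)
  qed
  then show ?case
    unfolding node_fun_eq[OF assms(1,2), of m Ne f i] by (intro sum.cong refl) presburger
qed

lemma node_fun_zero:
  assumes "finite E" and "acyclic E" and "\<forall>(i, j)\<in>E. f i j 0 = 0"
  shows "node_fun E m Ne f i (\<lambda>_ _. 0) = 0"
proof (induction i rule: wf_induct_rule[OF finite_acyclic_wf_converse[OF assms(1,2)]])
  case (1 i)
  then show ?case
    using assms(3)
    by (subst node_fun_eq[OF assms(1,2)]) (auto simp: in_nbrs_def delay_def intro!: sum.neutral)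
qed

lemma continuous_on_node_fun:
  assumes "finite E" and "acyclic E" and cont: "\<forall>(i, j)\<in>E. continuous_on UNIV (f i j)"
    and "\<And>l s. continuous_on UNIV (\<lambda>t::real. W t l s)"
  shows "continuous_on UNIV (\<lambda>t. node_fun E m Ne f i (W t))"
  using assms(4)
proof (induction i arbitrary: W rule: wf_induct_rule[OF finite_acyclic_wf_converse[OF assms(1,2)]])
  case (1 i)
  have "continuous_on UNIV (\<lambda>t. f i j ((if j \<in> Ne then W t j (m i j + 1) else 0)
      + node_fun E m Ne f j (delay (m i j) (W t))))" if "j \<in> in_nbrs E i" for j
  proof (rule continuous_on_compose2[of UNIV "f i j"])
    have e: "(i, j) \<in> E"
      using that by (simp add: in_nbrs_def)
    then show "continuous_on UNIV (f i j)"
      using cont by blast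
    have "continuous_on UNIV (\<lambda>t. node_fun E m Ne f j (delay (m i j) (W t)))"
      using e by (intro 1(1)) (auto simp: delay_def intro: 1(2))
    moreover have "continuous_on UNIV (\<lambda>t. if j \<in> Ne then W t j (m i j + 1) else 0)"
      using 1(2) by (cases "j \<in> Ne") auto
    ultimately show "continuous_on UNIV (\<lambda>t. (if j \<in> Ne then W t j (m i j + 1) else 0)
        + node_fun E m Ne f j (delay (m i j) (W t)))"
      by (intro continuous_on_add)
  qed simp
  then show ?case
    by (subst node_fun_eq[OF assms(1,2)]) (rule continuous_on_sum)
qed

text \<open>Any other path from \<open>j\<close> to \<open>i\<close> would start with an edge into
  an out-neighbour of \<open>j\<close> lying strictly upstream of \<open>i\<close>, contrary to
  \<open>first\<close>. So \<open>x\<close> enters only through the edge itself, and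
  \<open>R\<close> collects the summands of the other in-neighbours.\<close>

lemma node_fun_single_path:
  assumes E: "finite E" "acyclic E" "(i, j) \<in> E" "j \<in> Ne"
    and first: "\<And>k. (i, k) \<in> E\<^sup>+ \<Longrightarrow> (k, j) \<notin> E"
  obtains R where "\<And>x. node_fun E m Ne f i (w(j := \<lambda>_. x))
    = f i j (x + node_fun E m Ne f j (delay (m i j) w)) + R"
proof
  fix x
  have indep: "node_fun E m Ne f k (delay s (w(j := \<lambda>_. x))) = node_fun E m Ne f k (delay s w)"
    if "(i, k) \<in> E" for k s
  proof (rule node_fun_cong[OF E(1,2)])
    fix l r
    assume "(k, l) \<in> E\<^sup>+"
    then obtain k' where "(k, k') \<in> E\<^sup>*" "(k', l) \<in> E"
      by (meson tranclD2)
    moreover from this that have "(i, k') \<in> E\<^sup>+"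
      by simp
    ultimately have "l \<noteq> j"
      using first by blast
    then show "delay s (w(j := \<lambda>_. x)) l r = delay s w l r"
      by (simp add: delay_def)
  qed
  let ?T = "\<lambda>w k. f i k ((if k \<in> Ne then w k (m i k + 1) else 0)
    + node_fun E m Ne f k (delay (m i k) w))"
  have "finite (in_nbrs E i)"
    using finite_imageI[OF E(1), of snd] by (rule rev_finite_subset) (force simp: in_nbrs_def)
  moreover have "j \<in> in_nbrs E i"
    using E(3) by (simp add: in_nbrs_def)
  ultimately have "node_fun E m Ne f i (w(j := \<lambda>_. x))
      = ?T (w(j := \<lambda>_. x)) j + (\<Sum>k\<in>in_nbrs E i - {j}. ?T (w(j := \<lambda>_. x)) k)"
    unfolding node_fun_eq[OF E(1,2), of m Ne f i] by (rule sum.remove)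
  also have "(\<Sum>k\<in>in_nbrs E i - {j}. ?T (w(j := \<lambda>_. x)) k) = (\<Sum>k\<in>in_nbrs E i - {j}. ?T w k)"
    using indep by (intro sum.cong) (simp_all add: in_nbrs_def)
  also have "?T (w(j := \<lambda>_. x)) j = f i j (x + node_fun E m Ne f j (delay (m i j) w))"
    using E(4) indep[OF E(3)] by simp
  finally show "node_fun E m Ne f i (w(j := \<lambda>_. x))
    = f i j (x + node_fun E m Ne f j (delay (m i j) w)) + (\<Sum>k\<in>in_nbrs E i - {j}. ?T w k)" .
qed

text \<open>Minimality is taken for the transitive closure, so that it rules out out-neighbours of
  \<open>j\<close> at any distance upstream of \<open>i\<close>.\<close>

lemma first_out_nbr:
  assumes "finite E" and "acyclic E" and "out_nbrs E j \<noteq> {}"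
  obtains i where "(i, j) \<in> E" and "\<And>k. (i, k) \<in> E\<^sup>+ \<Longrightarrow> (k, j) \<notin> E"
proof -
  have "wf ((E\<inverse>)\<^sup>+)"
    using assms by (intro wf_trancl finite_acyclic_wf_converse)
  then obtain i where "i \<in> out_nbrs E j" "\<And>k. (k, i) \<in> (E\<inverse>)\<^sup>+ \<Longrightarrow> k \<notin> out_nbrs E j"
    using assms(3) by (meson ex_in_conv wfE_min)
  then show ?thesis
    by (intro that[of i]) (auto simp: out_nbrs_def trancl_converse)
qed

section \<open>From an out-neighbour back to an excited node\<close>

lemma node_fun_determined_by_out_nbr:
  assumes E: "finite E" "acyclic E" "(i, j) \<in> E" "j \<in> Ne"
    and first: "\<And>k. (i, k) \<in> E\<^sup>+ \<Longrightarrow> (k, j) \<notin> E"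
    and f: "\<forall>(i, j)\<in>E. f i j \<in> F_ZNL" and g: "\<forall>(i, j)\<in>E. g i j \<in> F_ZNL"
    and eq: "node_fun E m Ne f i = node_fun E m Ne g i"
  shows "node_fun E m Ne f j = node_fun E m Ne g j"
proof
  fix w
  let ?F = "node_fun E m Ne f j" and ?G = "node_fun E m Ne g j"
  have fE0: "\<forall>(i, j)\<in>E. f i j 0 = 0" and gE0: "\<forall>(i, j)\<in>E. g i j 0 = 0"
    using f g by (auto simp: F_ZNL_def)
  then have f0: "f i j 0 = 0" and g0: "g i j 0 = 0"
    using E(3) by auto
  have key: "\<exists>c. \<forall>x. f i j (x + ?F v) = g i j (x + ?G v) + c" for v
  proof -
    \<comment> \<open>Undoes the delay along the edge. Truncated subtraction is harmless, since the
      delayed input reads \<open>u\<close> only at times \<open>s \<ge> m i j\<close>.\<close>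
    define u where "u = (\<lambda>l s. v l (s - m i j))"
    have "delay (m i j) u = v"
      by (simp add: delay_def u_def)
    moreover obtain R where "\<And>x. node_fun E m Ne f i (u(j := \<lambda>_. x))
        = f i j (x + ?F (delay (m i j) u)) + R"
      using node_fun_single_path[OF E first] by blast
    moreover obtain S where "\<And>x. node_fun E m Ne g i (u(j := \<lambda>_. x))
        = g i j (x + ?G (delay (m i j) u)) + S"
      using node_fun_single_path[OF E first] by blast
    ultimately have "\<forall>x. f i j (x + ?F v) = g i j (x + ?G v) + (S - R)"
      using eq by (simp add: algebra_simps)
    then show ?thesis ..
  qed
  obtain c where "f i j x = g i j x + c" for x
    using key[of "\<lambda>_ _. 0"]
    by (auto simp: node_fun_zero[where f = f, OF E(1,2) fE0] node_fun_zero[where f = g, OF E(1,2) gE0])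
  then have fg: "g i j = f i j"
    using f0 g0 by (metis add_0 add.right_neutral ext)
  \<comment> \<open>\<open>D\<close> runs continuously from 0 at \<open>t = 0\<close> to the
    difference at \<open>w\<close> at \<open>t = 1\<close>, so every shift in between is attained. A
    single nonzero shift would not suffice: \<open>x + sin x\<close> changes by a constant under a
    shift by \<open>2 * pi\<close>.\<close>
  define D where "D t = ?F (\<lambda>l s. t * w l s) - ?G (\<lambda>l s. t * w l s)" for t
  have cont: "continuous_on UNIV h" if "h \<in> F_ZNL" for h
    using that real_analytic_imp_differentiable[of h] DERIV_isCont
    by (intro continuous_at_imp_continuous_on) (unfold F_ZNL_def, blast)
  have "continuous_on UNIV D"
    unfolding D_def
    by (intro continuous_on_diff continuous_on_node_fun E continuous_intros)
      (use f g cont in auto)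
  then have "connected (range D)"
    by (intro connected_continuous_image) auto
  moreover have "0 \<in> range D"
    by (rule range_eqI[of _ _ 0])
      (simp add: D_def node_fun_zero[where f = f, OF E(1,2) fE0] node_fun_zero[where f = g, OF E(1,2) gE0])
  moreover have "?F w - ?G w \<in> range D"
    by (rule range_eqI[of _ _ 1]) (simp add: D_def)
  ultimately have seg: "closed_segment 0 (?F w - ?G w) \<subseteq> range D"
    by (intro closed_segment_subset) (simp_all flip: is_interval_connected_1 add: is_interval_convex_1)
  have "?F w - ?G w = 0"
  proof (rule F_ZNL_shift_constant_interval[of "f i j"])
    show "f i j \<in> F_ZNL"
      using f E(3) by blast
    fix e
    assume "e \<in> closed_segment 0 (?F w - ?G w)"
    then obtain t where e: "e = D t"
      using seg by blast
    obtain c where "\<forall>x. f i j (x + ?F (\<lambda>l s. t * w l s)) = f i j (x + ?G (\<lambda>l s. t * w l s)) + c"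
      using key[of "\<lambda>l s. t * w l s"] unfolding fg by blast
    then have "f i j (x + e) = f i j x + c" for x
      unfolding e D_def
      by (drule_tac x = "x - ?G (\<lambda>l s. t * w l s)" in spec) (simp add: algebra_simps)
    then show "\<exists>c. \<forall>x. f i j (x + e) = f i j x + c"
      by blast
  qed
  then show "?F w = ?G w"
    by simp
qed

theorem proposition3:
  fixes n :: nat and V :: "nat set" and E :: "(nat \<times> nat) set"
    and m :: "nat \<Rightarrow> nat \<Rightarrow> nat" and Ne Nm :: "nat set"
  assumes "V = {1..n}"
    and "weakly_connected_dag V E"
    and "\<forall>(i, j)\<in>E. m i j \<ge> 1"
    and "Ne \<subseteq> V" and "Nm \<subseteq> V"
    and "sources V E \<subseteq> Ne"
    and "sinks V E \<subseteq> Nm"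
    and "V - (sources V E \<union> sinks V E) \<subseteq> Ne \<union> Nm"
  shows "identifiable F_ZNL E m Ne Nm \<longleftrightarrow> identifiable F_ZNL E m Ne V"
proof -
  have sub: "E \<subseteq> V \<times> V" and "acyclic E"
    using assms(2) by (auto simp: weakly_connected_dag_def)
  have "finite E"
    using sub by (rule finite_subset) (simp add: assms(1))
  have all_nodes: "node_fun E m Ne f j = node_fun E m Ne g j"
    if f: "\<forall>(i, j)\<in>E. f i j \<in> F_ZNL" and g: "\<forall>(i, j)\<in>E. g i j \<in> F_ZNL"
      and meas: "\<forall>i\<in>Nm. node_fun E m Ne f i = node_fun E m Ne g i" and "j \<in> V" for f g j
    using \<open>j \<in> V\<close>
  \<comment> \<open>Edges point from second to first component, so the induction hypothesis covers
    the out-neighbours of \<open>j\<close>.\<close>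
  proof (induction j rule: wf_induct_rule[OF finite_acyclic_wf[OF \<open>finite E\<close> \<open>acyclic E\<close>]])
    case (1 j)
    show ?case
    proof (cases "j \<in> Nm")
      case True
      with meas show ?thesis
        by blast
    next
      case False
      with 1(2) assms(6-8) have "j \<in> Ne" "j \<notin> sinks V E"
        by auto
      with 1(2) have "out_nbrs E j \<noteq> {}"
        by (simp add: sinks_def)
      then obtain i where i: "(i, j) \<in> E" "\<And>k. (i, k) \<in> E\<^sup>+ \<Longrightarrow> (k, j) \<notin> E"
        using first_out_nbr[OF \<open>finite E\<close> \<open>acyclic E\<close>] by blast
      then have "node_fun E m Ne f i = node_fun E m Ne g i"
        using 1(1) sub by blast
      then show ?thesis
        using node_fun_determined_by_out_nbr[OF \<open>finite E\<close> \<open>acyclic E\<close> i(1) \<open>j \<in> Ne\<close> i(2) f g]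
        by blast
    qed
  qed
  \<comment> \<open>The two identifiability statements differ only in this premise.\<close>
  have "(\<forall>i\<in>Nm. node_fun E m Ne f i = node_fun E m Ne g i) \<longleftrightarrow>
      (\<forall>i\<in>V. node_fun E m Ne f i = node_fun E m Ne g i)"
    if "\<forall>(i, j)\<in>E. f i j \<in> F_ZNL" "\<forall>(i, j)\<in>E. g i j \<in> F_ZNL" for f g
    using all_nodes[OF that] assms(5) by blast
  then show ?thesis
    unfolding identifiable_def by (intro all_cong1 imp_cong refl)
qed

end
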